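(* Let $p$ be an odd prime, $\lambda\in\mathbb{C}_p$ with $\lambda\neq0$, and $x\in\mathbb{C}_p$. For every integer $n\ge0$, \[ E_{n,\lambda}(x)=\int_{\mathbb{Z}_p}\left(x+y+\tfrac12\right)_{n,\lambda}d\mu_{-1}(y)=\sum_{l=0}^{n}S_{1,\lambda}(n,l)E_l(x)=\sum_{m=0}^{n}\binom{n}{m}E_{m,\lambda}(x)_{n-m,\lambda}. \]
   Context: Fermionic $p$-adic integral: $\int_{\mathbb{Z}_p}f(y)\,d\mu_{-1}(y)=\lim_{N\to\infty}\sum_{y=0}^{p^N-1}(-1)^yf(y)$. $(x)_{0,\lambda}=1$, $(x)_{k,\lambda}=x(x-\lambda)\cdots(x-(k-1)\lambda)$ for $k\ge1$; $e_\lambda^x(t)=(1+\lambda t)^{x/\lambda}=\sum_{k\ge0}(x)_{k,\lambda}\frac{t^k}{k!}$. Degenerate Stirling numbers of the first kind: $(x)_{n,\lambda}=\sum_{l=0}^nS_{1,\lambda}(n,l)x^l$. Type 2 Euler polynomials: $\frac{2}{e^{t/2}+e^{-t/2}}e^{xt}=\sum_{n\ge0}E_n(x)\frac{t^n}{n!}$. Degenerate type 2 Euler polynomials: $\frac{2}{e_\lambda^{1/2}(t)+e_\lambda^{-1/2}(t)}e_\lambda^x(t)=\sum_{n\ge0}E_{n,\lambda}(x)\frac{t^n}{n!}$, with $E_{n,\lambda}=E_{n,\lambda}(0)$. Generating functions are formal power series in $t$. *)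

theory Defs
  imports "HOL-Analysis.Analysis" "HOL-Computational_Algebra.Computational_Algebra"
begin

section \<open>The field of p-adic complex numbers\<close>

text \<open>
  The field \<open>\<complex>\<^sub>p\<close> is the completion of an algebraic closure of \<open>\<rat>\<^sub>p\<close>, the completion of \<open>\<rat>\<close>
  for the p-adic absolute value. These objects are unique only up to isometric isomorphism, so
  they are described inside a complete valued field \<open>'a\<close>: there \<open>\<rat>\<^sub>p\<close> is the closure of \<open>\<rat>\<close>.
\<close>

definition padic_rats :: "'a::{field_char_0, metric_space} set" where
  "padic_rats = closure \<rat>"

definition padic_algebraic :: "'a::{field_char_0, metric_space} set" where
  "padic_algebraic = {z. \<exists>q. q \<noteq> 0 \<and> set (coeffs q) \<subseteq> padic_rats \<and> poly q z = 0}"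

text \<open>
  Completeness of \<open>'a\<close> comes from the sort. The conditions on the absolute value \<open>v\<close> force it to be
  the p-adic one on the rationals, normalised by \<open>v p = 1/p\<close>. The last but one condition says that
  \<open>padic_algebraic\<close> is an algebraic closure of \<open>\<rat>\<^sub>p\<close>, and the last one that \<open>'a\<close> is its completion.
\<close>

definition is_padic_complex ::
  "nat \<Rightarrow> ('a::{field_char_0, complete_space} \<Rightarrow> real) \<Rightarrow> bool" where
  "is_padic_complex p v \<longleftrightarrow>
     (\<forall>x y. dist x y = v (x - y)) \<and>
     (\<forall>x y. v (x * y) = v x * v y) \<and>
     (\<forall>x y. v (x + y) \<le> max (v x) (v y)) \<and>
     v (of_nat p) = 1 / real p \<and>
     (\<forall>q :: 'a poly. degree q > 0 \<and> set (coeffs q) \<subseteq> padic_algebraic \<longrightarrow>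
        (\<exists>z\<in>padic_algebraic. poly q z = 0)) \<and>
     closure (padic_algebraic :: 'a set) = UNIV"

section \<open>The fermionic p-adic integral\<close>

text \<open>
  \<open>\<int>\<^sub>p\<close> is regarded as a subset of \<open>'a\<close>. The defining limit only involves the values of the integrand
  at natural numbers; since \<open>lim\<close> is unspecified for divergent sequences, existence of the
  limit is a separate predicate.
\<close>

definition fermionic_sum :: "nat \<Rightarrow> ('a::field_char_0 \<Rightarrow> 'a) \<Rightarrow> nat \<Rightarrow> 'a" where
  "fermionic_sum p f N = (\<Sum>y<p ^ N. (-1) ^ y * f (of_nat y))"

definition fermionic_integrable :: "nat \<Rightarrow> ('a::{field_char_0, metric_space} \<Rightarrow> 'a) \<Rightarrow> bool" where
  "fermionic_integrable p f \<longleftrightarrow> convergent (fermionic_sum p f)"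

definition fermionic_integral :: "nat \<Rightarrow> ('a::{field_char_0, metric_space} \<Rightarrow> 'a) \<Rightarrow> 'a" where
  "fermionic_integral p f = lim (fermionic_sum p f)"

section \<open>Degenerate falling factorials, exponentials and Stirling numbers\<close>

definition deg_ffact :: "'a::comm_ring_1 \<Rightarrow> 'a \<Rightarrow> nat \<Rightarrow> 'a" where
  "deg_ffact lam x k = (\<Prod>i<k. x - of_nat i * lam)"

definition deg_exp :: "'a::field_char_0 \<Rightarrow> 'a \<Rightarrow> 'a fps" where
  "deg_exp lam x = Abs_fps (\<lambda>k. deg_ffact lam x k / fact k)"

text \<open>The formal power series \<open>(1 + lam t)\<close> to the power \<open>x/lam\<close>.\<close>

lemma deg_exp_eq_binomial:
  assumes "lam \<noteq> 0"
  shows "deg_exp lam x = fps_compose (fps_binomial (x / lam)) (fps_const lam * fps_X)"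
proof (rule fps_ext)
  fix k
  have "deg_ffact lam x k = (\<Prod>i<k. lam * (x / lam - of_nat i))"
    unfolding deg_ffact_def using assms by (intro prod.cong) (simp_all add: field_simps)
  also have "\<dots> = lam ^ k * (\<Prod>i<k. x / lam - of_nat i)"
    by (simp add: prod.distrib)
  finally show "fps_nth (deg_exp lam x) k =
      fps_nth (fps_compose (fps_binomial (x / lam)) (fps_const lam * fps_X)) k"
    by (simp add: deg_exp_def gbinomial_prod_rev atLeast0LessThan fps_compose_linear)
qed

text \<open>The coefficients of the degenerate falling factorial of the indeterminate \<open>X\<close>.\<close>

definition deg_stirling1 :: "'a::comm_ring_1 \<Rightarrow> nat \<Rightarrow> nat \<Rightarrow> 'a" where
  "deg_stirling1 lam n l = coeff (deg_ffact [:lam:] [:0, 1:] n) l"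

lemma deg_ffact_eq_sum_stirling1:
  fixes x :: "'a::comm_ring_1"
  shows "deg_ffact lam x n = (\<Sum>l\<le>n. deg_stirling1 lam n l * x ^ l)"
proof -
  have "degree (deg_ffact [:lam:] [:0, 1:] n) \<le> n"
  proof (induction n)
    case (Suc n)
    have "degree ([:0, 1:] - of_nat n * [:lam:]) \<le> 1"
      by (simp add: of_nat_poly)
    with Suc show ?case
      using degree_mult_le [of "deg_ffact [:lam:] [:0, 1:] n" "[:0, 1:] - of_nat n * [:lam:]"]
      by (simp add: deg_ffact_def)
  qed (simp add: deg_ffact_def)
  moreover have "poly (deg_ffact [:lam:] [:0, 1:] n) x = deg_ffact lam x n"
    by (simp add: deg_ffact_def poly_prod of_nat_poly mult.commute)
  ultimately show ?thesis
    using poly_as_sum_of_monoms' [of "deg_ffact [:lam:] [:0, 1:] n" n]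
    by (metis (no_types, lifting) deg_stirling1_def poly_monom poly_sum sum.cong)
qed

section \<open>Type 2 Euler polynomials\<close>

definition euler2 :: "nat \<Rightarrow> 'a::field_char_0 \<Rightarrow> 'a" where
  "euler2 n x =
     fact n * fps_nth (2 / (fps_exp (1 / 2) + fps_exp (- 1 / 2)) * fps_exp x) n"

definition deg_euler2 :: "'a::field_char_0 \<Rightarrow> nat \<Rightarrow> 'a \<Rightarrow> 'a" where
  "deg_euler2 lam n x =
     fact n * fps_nth (2 / (deg_exp lam (1 / 2) + deg_exp lam (- 1 / 2)) * deg_exp lam x) n"

end

theory Submission
  imports Defs
begin

text \<open>
  If \<open>F\<close> is a polynomial with \<open>F (y + 1) + F y = 2 f y\<close>, the alternating sum of \<open>2 f\<close> over
  \<open>y < p\<^sup>N\<close> telescopes to \<open>F 0 + F (p\<^sup>N)\<close> because \<open>p\<^sup>N\<close> is odd, and this tends to \<open>2 F 0\<close>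
  because \<open>p\<^sup>N\<close> tends to \<open>0\<close>; so the fermionic integral of \<open>f\<close> is \<open>F 0\<close>. For
  \<open>f y = (x + y + 1/2)\<^sub>n\<^sub>,\<^sub>\<lambda>\<close> the equation is solved both by \<open>F y = E\<^sub>n\<^sub>,\<^sub>\<lambda> (x + y)\<close> and by
  \<open>F y = \<Sum>\<^sub>l S\<^sub>1\<^sub>,\<^sub>\<lambda> (n, l) E\<^sub>l (x + y)\<close>, as the generating functions show.
\<close>

text \<open>The binomial series turns a sum of exponents into a product, and substituting
  \<open>lam t\<close> for the variable preserves products.\<close>

lemma deg_exp_add:
  assumes "lam \<noteq> 0"
  shows "deg_exp lam (x + y) = deg_exp lam x * deg_exp lam y"
  unfolding deg_exp_eq_binomial [OF assms] add_divide_distrib fps_binomial_add_mult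
  by (rule fps_compose_mult_distrib) simp

lemma deg_exp_nth_0 [simp]: "fps_nth (deg_exp lam x) 0 = 1"
  by (simp add: deg_exp_def deg_ffact_def)

text \<open>Both \<open>A (z + 1)\<close> and \<open>A z\<close> contain the factor
  \<open>A (z + 1 / 2)\<close>; the cofactors add up to the denominator, which cancels. An abstract
  \<open>A\<close> covers \<open>deg_exp lam\<close> and \<open>fps_exp\<close> at once.\<close>

lemma euler_fps_shift:
  fixes A :: "'a::field_char_0 \<Rightarrow> 'a fps"
  assumes add: "\<And>x y. A (x + y) = A x * A y" and one: "\<And>x. fps_nth (A x) 0 = 1"
  defines "G \<equiv> \<lambda>z. 2 / (A (1 / 2) + A (- 1 / 2)) * A z"
  shows "G (z + 1) + G z = 2 * A (z + 1 / 2)"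
proof -
  let ?D = "A (1 / 2) + A (- 1 / 2)"
  \<comment> \<open>The constant term is 2, so the denominator is an invertible power
    series.\<close>
  have unit: "fps_nth ?D 0 \<noteq> 0"
    by (simp add: one)
  have "A (z + 1) = A (z + 1 / 2) * A (1 / 2)" "A z = A (z + 1 / 2) * A (- 1 / 2)"
    by (simp_all flip: add add: algebra_simps)
  then have "G (z + 1) + G z = (2 / ?D * ?D) * A (z + 1 / 2)"
    unfolding G_def by (simp only: algebra_simps)
  also have "2 / ?D * ?D = 2"
    using unit by (simp only: fps_divide_unit mult.assoc inverse_mult_eq_1 mult_1_right not_False_eq_True)
  finally show ?thesis .
qed

lemma deg_euler2_shift:
  assumes "lam \<noteq> 0"
  shows "deg_euler2 lam n (z + 1) + deg_euler2 lam n z = 2 * deg_ffact lam (z + 1 / 2) n"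
proof -
  have "deg_euler2 lam n (z + 1) + deg_euler2 lam n z = fact n * fps_nth (2 * deg_exp lam (z + 1 / 2)) n"
    unfolding deg_euler2_def
    by (subst euler_fps_shift [of "deg_exp lam", OF deg_exp_add [OF assms] deg_exp_nth_0, symmetric])
      (simp add: algebra_simps)
  also have "\<dots> = 2 * deg_ffact lam (z + 1 / 2) n"
    by (simp add: numeral_fps_const deg_exp_def)
  finally show ?thesis .
qed

lemma euler2_shift: "euler2 n (z + 1) + euler2 n z = 2 * (z + 1 / 2) ^ n"
proof -
  have "euler2 n (z + 1) + euler2 n z = fact n * fps_nth (2 * fps_exp (z + 1 / 2)) n"
    unfolding euler2_def
    by (subst euler_fps_shift [of fps_exp, OF fps_exp_add_mult, symmetric]) (simp_all add: algebra_simps)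
  also have "\<dots> = 2 * (z + 1 / 2) ^ n"
    by (simp add: numeral_fps_const)
  finally show ?thesis .
qed

text \<open>Cauchy product of the generating function at 0 with \<open>deg_exp lam x\<close>; the
  factorials combine into binomial coefficients.\<close>

lemma deg_euler2_eq_sum:
  "deg_euler2 lam n x =
    (\<Sum>m=0..n. of_nat (n choose m) * deg_euler2 lam m 0 * deg_ffact lam x (n - m))"
proof -
  have exp_0: "deg_exp lam 0 = 1"
    by (rule fps_ext) (auto simp: deg_exp_def deg_ffact_def)
  show ?thesis
    unfolding deg_euler2_def exp_0 fps_mult_nth mult_1_right sum_distrib_left
    by (intro sum.cong) (auto simp: deg_exp_def binomial_fact)
qed

text \<open>Being polynomial in \<open>y\<close> is what later yields convergence along
  \<open>p ^ N\<close>. In the Cauchy product only the falling factorials depend on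
  \<open>y\<close>, and they are products of linear factors.\<close>

lemma deg_euler2_poly: "\<exists>q. \<forall>y. deg_euler2 lam n (x + y) = poly q y"
proof -
  have "deg_ffact lam (x + y) k = poly (\<Prod>i<k. [:x - of_nat i * lam, 1:]) y" for y k
    by (simp add: deg_ffact_def poly_prod algebra_simps)
  then have "deg_euler2 lam n (x + y) =
      poly (\<Sum>m=0..n. smult (of_nat (n choose m) * deg_euler2 lam m 0)
              (\<Prod>i<n - m. [:x - of_nat i * lam, 1:])) y" for y
    by (subst deg_euler2_eq_sum) (simp add: poly_sum)
  then show ?thesis
    by blast
qed

lemma euler2_poly: "\<exists>q. \<forall>y. euler2 n (x + y) = poly q y"
proof -
  let ?c = "\<lambda>i. fps_nth (2 / (fps_exp (1 / 2) + fps_exp (- 1 / 2)) :: 'a fps) i"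
  have "euler2 n (x + y) =
      poly (\<Sum>i=0..n. smult (fact n * ?c i / fact (n - i)) ([:x, 1:] ^ (n - i))) y" for y
    unfolding euler2_def fps_mult_nth poly_sum sum_distrib_left
    by (intro sum.cong) simp_all
  then show ?thesis
    by blast
qed

lemma fermionic_sum_telescope:
  fixes F :: "'a::field_char_0 \<Rightarrow> 'a"
  assumes "odd p" and "\<And>y. F (y + 1) + F y = 2 * f y"
  shows "2 * fermionic_sum p f N = F 0 + F (of_nat (p ^ N))"
proof -
  \<comment> \<open>An arbitrary bound \<open>M\<close> allows induction; the sign of the boundary
    term is fixed only at the odd number \<open>M = p ^ N\<close>.\<close>
  have "2 * (\<Sum>y<M. (- 1) ^ y * f (of_nat y)) = F 0 - (- 1) ^ M * F (of_nat M)" for M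
  proof (induction M)
    case (Suc M)
    have "2 * f (of_nat M) = F (of_nat (Suc M)) + F (of_nat M)"
      using assms(2) [of "of_nat M"] by (simp add: add.commute)
    then have "2 * ((- 1) ^ M * f (of_nat M)) = (- 1) ^ M * (F (of_nat (Suc M)) + F (of_nat M))"
      by (metis mult.left_commute)
    with Suc show ?case
      by (simp add: distrib_left del: of_nat_Suc)
  qed simp
  moreover have "(- 1 :: 'a) ^ (p ^ N) = - 1"
    using assms(1) by simp
  ultimately show ?thesis
    by (simp only: fermionic_sum_def) simp
qed

locale ultrametric_value =
  fixes v :: "'a::{field_char_0, metric_space} \<Rightarrow> real"
  assumes dist_eq: "dist x y = v (x - y)"
    and mult: "v (x * y) = v x * v y"
    and add_le: "v (x + y) \<le> max (v x) (v y)"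
begin

lemma nonneg: "0 \<le> v x"
  using dist_eq [of x 0] by (metis diff_zero zero_le_dist)

lemma zero: "v 0 = 0"
  using dist_eq [of 0 0] by simp

lemma one: "v 1 = 1"
proof -
  have "v 1 \<noteq> 0"
    using dist_eq [of 1 0] by (metis diff_zero dist_eq_0_iff zero_neq_one)
  then show ?thesis
    using mult [of 1 1] by simp
qed

lemma power: "v (x ^ n) = v x ^ n"
  by (induction n) (simp_all add: one mult)

lemma of_nat_le_1: "v (of_nat n) \<le> 1"
proof (induction n)
  case (Suc n)
  then show ?case
    using add_le [of 1 "of_nat n"] by (simp add: one)
qed (simp add: zero)

text \<open>Horner's scheme: multiplying by \<open>z\<close> in the unit ball does not increase
  \<open>v\<close>, and adding a coefficient \<open>a\<close> raises the bound at most to the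
  maximum with \<open>v a\<close>.\<close>

lemma poly_bounded: "\<exists>B. \<forall>z. v z \<le> 1 \<longrightarrow> v (poly q z) \<le> B"
proof (induction q)
  case (pCons a q)
  then obtain B where B: "\<And>z. v z \<le> 1 \<Longrightarrow> v (poly q z) \<le> B"
    by blast
  have "v (poly (pCons a q) z) \<le> max (v a) B" if "v z \<le> 1" for z
  proof -
    have "v (z * poly q z) \<le> v (poly q z)"
      using that nonneg by (simp add: mult mult_left_le_one_le)
    then show ?thesis
      using add_le [of a "z * poly q z"] B [OF that] by simp
  qed
  then show ?case
    by blast
qed (auto simp: zero)

text \<open>Write \<open>q = a + X r\<close>. The difference at \<open>z = p ^ N\<close> is
  \<open>z * poly r z\<close>, where the first factor tends to 0 and the second is bounded, as
  natural numbers lie in the unit ball.\<close>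

lemma poly_of_nat_power_tendsto:
  assumes "v (of_nat p) < 1"
  shows "(\<lambda>N. v (poly q (of_nat (p ^ N)) - poly q 0)) \<longlonglongrightarrow> 0"
proof (cases q)
  case (pCons a r)
  obtain B where B: "\<And>z. v z \<le> 1 \<Longrightarrow> v (poly r z) \<le> B"
    using poly_bounded by blast
  have bound: "v (poly q (of_nat (p ^ N)) - poly q 0) \<le> v (of_nat p) ^ N * B" for N
  proof -
    have "v (poly q (of_nat (p ^ N)) - poly q 0) = v (of_nat p) ^ N * v (poly r (of_nat (p ^ N)))"
      by (simp add: pCons mult power)
    then show ?thesis
      using B [OF of_nat_le_1 [of "p ^ N"]] by (metis mult_left_mono nonneg zero_le_power)
  qed
  have "(\<lambda>N. v (of_nat p) ^ N * B) \<longlonglongrightarrow> 0"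
    using assms nonneg by (intro tendsto_mult_left_zero LIMSEQ_power_zero) auto
  then show ?thesis
    by (rule Lim_null_comparison [rotated]) (simp add: nonneg bound del: of_nat_power)
qed

lemma fermionic_sum_tendsto:
  fixes F :: "'a \<Rightarrow> 'a"
  assumes "odd p" and "v (of_nat p) < 1"
    and shift: "\<And>y. F (y + 1) + F y = 2 * f y"
    and poly: "\<exists>q. \<forall>y. F y = poly q y"
  shows "fermionic_sum p f \<longlonglongrightarrow> F 0"
proof -
  obtain q where q: "\<And>y. F y = poly q y"
    using poly by blast
  have "fermionic_sum p f N - F 0 = 1 / 2 * (F (of_nat (p ^ N)) - F 0)" for N
    using fermionic_sum_telescope [where F = F and f = f, OF assms(1) shift, of N]
    by (simp add: field_simps)
  then have "dist (fermionic_sum p f N) (F 0) =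
      v (1 / 2) * v (poly q (of_nat (p ^ N)) - poly q 0)" for N
    by (simp only: dist_eq mult q)
  moreover have "(\<lambda>N. v (1 / 2) * v (poly q (of_nat (p ^ N)) - poly q 0)) \<longlonglongrightarrow> 0"
    by (intro tendsto_mult_right_zero poly_of_nat_power_tendsto assms)
  ultimately show ?thesis
    by (subst tendsto_dist_iff) simp
qed

end

theorem theorem2p16:
  fixes p n :: nat
    and v :: "'a::{field_char_0, complete_space} \<Rightarrow> real"
    and lam x :: 'a
  assumes "prime p" and "odd p"
    and "is_padic_complex p v"
    and "lam \<noteq> 0"
  shows "fermionic_integrable p (\<lambda>y. deg_ffact lam (x + y + 1 / 2) n)
    \<and> deg_euler2 lam n x = fermionic_integral p (\<lambda>y. deg_ffact lam (x + y + 1 / 2) n)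
    \<and> fermionic_integral p (\<lambda>y. deg_ffact lam (x + y + 1 / 2) n)
        = (\<Sum>l=0..n. deg_stirling1 lam n l * euler2 l x)
    \<and> (\<Sum>l=0..n. deg_stirling1 lam n l * euler2 l x)
        = (\<Sum>m=0..n. of_nat (n choose m) * deg_euler2 lam m 0 * deg_ffact lam x (n - m))"
proof -
  let ?f = "\<lambda>y. deg_ffact lam (x + y + 1 / 2) n"
  let ?S = "\<lambda>y. \<Sum>l=0..n. deg_stirling1 lam n l * euler2 l (x + y)"
  interpret ultrametric_value v
    using assms(3) unfolding is_padic_complex_def by unfold_locales blast+
  have small: "v (of_nat p) < 1"
    using assms(3) prime_gt_1_nat [OF assms(1)] by (simp add: is_padic_complex_def)
  \<comment> \<open>The form \<open>x + 0\<close> exhibits the limit as the value at 0 of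
    \<open>F y = deg_euler2 lam n (x + y)\<close>.\<close>
  have "fermionic_sum p ?f \<longlonglongrightarrow> deg_euler2 lam n (x + 0)"
    using deg_euler2_shift [OF assms(4)] deg_euler2_poly
    by (intro fermionic_sum_tendsto [OF assms(2) small]) (simp_all flip: add.assoc)
  then have lim: "fermionic_sum p ?f \<longlonglongrightarrow> deg_euler2 lam n x"
    by simp
  have S_shift: "?S (y + 1) + ?S y = 2 * ?f y" for y
  proof -
    have "?S (y + 1) + ?S y =
        (\<Sum>l=0..n. deg_stirling1 lam n l * (euler2 l (x + y + 1) + euler2 l (x + y)))"
      by (simp add: sum.distrib distrib_left add.assoc)
    \<comment> \<open>Each bracket is \<open>2 * (x + y + 1 / 2) ^ l\<close>, and the Stirling
      numbers reassemble these powers into the falling factorial.\<close>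
    also have "\<dots> = 2 * ?f y"
      by (simp add: euler2_shift deg_ffact_eq_sum_stirling1 sum_distrib_left atLeast0AtMost
          mult.left_commute)
    finally show ?thesis .
  qed
  have S_poly: "\<exists>q. \<forall>y. ?S y = poly q y"
  proof -
    have "\<forall>l. \<exists>q. \<forall>y. euler2 l (x + y) = poly q y"
      using euler2_poly by blast
    then obtain q where "\<And>l y. euler2 l (x + y) = poly (q l) y"
      by metis
    then have "?S y = poly (\<Sum>l=0..n. smult (deg_stirling1 lam n l) (q l)) y" for y
      by (simp add: poly_sum)
    then show ?thesis
      by blast
  qed
  have "fermionic_sum p ?f \<longlonglongrightarrow> ?S 0"
    by (rule fermionic_sum_tendsto [OF assms(2) small S_shift S_poly])
  \<comment> \<open>The same sums have two limits, which must agree.\<close>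
  then have "deg_euler2 lam n x = (\<Sum>l=0..n. deg_stirling1 lam n l * euler2 l x)"
    using LIMSEQ_unique [OF lim] by simp
  moreover have "fermionic_integrable p ?f"
    unfolding fermionic_integrable_def using lim by (rule convergentI)
  moreover have "fermionic_integral p ?f = deg_euler2 lam n x"
    unfolding fermionic_integral_def using lim by (rule limI)
  ultimately show ?thesis
    using deg_euler2_eq_sum [of lam n x] by argo
qed

end
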